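(* Let $\Gamma$ be a distance-regular graph with intersection array $\{80,54,12;1,6,60\}$. Let $x$ be a vertex of $\Gamma$ and let $\Delta:=\Delta(x)$ be the local graph at $x$. Then $\Delta$ does not contain a coclique with $5$ vertices.
   Context: All graphs are finite, undirected and simple. A connected graph $\Gamma$ of diameter $D$ is distance-regular with intersection array $\{b_0,\ldots,b_{D-1};c_1,\ldots,c_D\}$ if for every $i\in\{0,\ldots,D\}$ and every pair of vertices $x,y$ at distance $i$, the number of neighbors of $y$ at distance $i-1$ from $x$ equals $c_i$ and the number of neighbors of $y$ at distance $i+1$ from $x$ equals $b_i$ (with $c_0=b_D=0$). The local graph $\Delta(x)$ at a vertex $x$ is the subgraph of $\Gamma$ induced on the neighbors of $x$. A coclique is a set of pairwise non-adjacent vertices. *)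

theory Defs
  imports "Graph_Theory.Digraph_Component" "Graph_Theory.Shortest_Path"
begin

text \<open>Undirected simple graphs are the symmetric loop-free digraphs without parallel arcs of the
  locale \<^locale>\<open>graph\<close>.\<close>

definition graph_dist :: "('a, 'b) pre_digraph \<Rightarrow> 'a \<Rightarrow> 'a \<Rightarrow> ereal" where
  "graph_dist G u v = wf_digraph.\<mu> G (\<lambda>_. 1) u v"

definition graph_diameter :: "('a, 'b) pre_digraph \<Rightarrow> ereal" where
  "graph_diameter G = (SUP u \<in> verts G. SUP v \<in> verts G. graph_dist G u v)"

text \<open>The list \<open>bs\<close> holds $b_0, \ldots, b_{D-1}$ and \<open>cs\<close> holds $c_1, \ldots, c_D$, so that
  \<open>(bs @ [0]) ! i\<close> is $b_i$ and \<open>(0 # cs) ! i\<close> is $c_i$ for $0 \le i \le D$, where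
  $b_D = c_0 = 0$. The distance \<open>real i - 1\<close> is a real number: for \<open>i = 0\<close> it is attained by no
  vertex.\<close>

definition distance_regular :: "('a, 'b) pre_digraph \<Rightarrow> nat list \<Rightarrow> nat list \<Rightarrow> bool" where
  "distance_regular G bs cs \<longleftrightarrow>
     graph G \<and> Digraph_Component.connected G \<and>
     length bs = length cs \<and> graph_diameter G = ereal (real (length bs)) \<and>
     (\<forall>i \<le> length bs. \<forall>x \<in> verts G. \<forall>y \<in> verts G. graph_dist G x y = ereal (real i) \<longrightarrow>
        card {z \<in> verts G. y \<rightarrow>\<^bsub>G\<^esub> z \<and> graph_dist G x z = ereal (real i - 1)} = (0 # cs) ! i \<and>
        card {z \<in> verts G. y \<rightarrow>\<^bsub>G\<^esub> z \<and> graph_dist G x z = ereal (real i + 1)} = (bs @ [0]) ! i)"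

definition local_graph :: "('a, 'b) pre_digraph \<Rightarrow> 'a \<Rightarrow> ('a, 'b) pre_digraph" where
  "local_graph G x = G \<restriction> {y \<in> verts G. x \<rightarrow>\<^bsub>G\<^esub> y}"

definition coclique :: "('a, 'b) pre_digraph \<Rightarrow> 'a set \<Rightarrow> bool" where
  "coclique G S \<longleftrightarrow> S \<subseteq> verts G \<and> pairwise (\<lambda>u v. \<not> u \<rightarrow>\<^bsub>G\<^esub> v) S"

end

theory Submission
  imports Defs
begin

text \<open>Inside the local graph, which has 80 vertices and is 25-regular, non-adjacent vertices have at
  most \<open>c\<^sub>2 - 1 = 5\<close> common neighbours. Since 5 * 26 - 10 * 5 = 80, inclusion-exclusion is tight for a
  coclique \<open>C\<close> with 5 vertices: every other vertex has one or two neighbours in \<open>C\<close>, and any two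
  vertices of \<open>C\<close> have exactly 5 common neighbours. Applying this also to the cocliques obtained from
  \<open>C\<close> by exchanging one or two vertices shows that every vertex outside \<open>C\<close> has exactly 5 common
  neighbours with each vertex of \<open>C\<close> it is not adjacent to. For distinct \<open>c\<close>, \<open>d\<close> in \<open>C\<close>, the 33
  vertices non-adjacent to both then induce a graph in which the sum of the degrees is odd.\<close>

section \<open>The local graph as an abstract 25-regular graph, and double counting in it\<close>

locale local_structure =
  fixes V :: "'a set" and N :: "'a \<Rightarrow> 'a set"
  assumes card_V: "card V = 80"
    and N_V: "N v \<subseteq> V"
    and sym: "u \<in> V \<Longrightarrow> v \<in> V \<Longrightarrow> u \<in> N v \<longleftrightarrow> v \<in> N u"
    and irrefl: "v \<notin> N v"
    and card_N: "v \<in> V \<Longrightarrow> card (N v) = 25"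
    and common_le: "u \<in> V \<Longrightarrow> v \<in> V \<Longrightarrow> u \<noteq> v \<Longrightarrow> v \<notin> N u \<Longrightarrow> card (N u \<inter> N v) \<le> 5"
begin

lemma finite_V [simp]: "finite V"
  using card_V card.infinite by fastforce

lemma finite_N [simp]: "finite (N v)"
  using N_V finite_V finite_subset by blast

lemma N_Int_V [simp]: "N v \<inter> V = N v"
  using N_V by blast

lemma in_V: "u \<in> N v \<Longrightarrow> u \<in> V"
  using N_V by blast

text \<open>Both sides count the adjacent pairs with one vertex in \<open>X\<close> and one in
  \<open>B\<close>.\<close>

lemma sum_card_N_Int:
  assumes "X \<subseteq> V" "B \<subseteq> V"
  shows "(\<Sum>v\<in>X. int (card (N v \<inter> B))) = (\<Sum>b\<in>B. int (card (N b \<inter> X)))"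
proof -
  have fin: "finite X" "finite B" using assms finite_V finite_subset by blast+
  have "(\<Sum>v\<in>X. int (card (N v \<inter> B))) = (\<Sum>v\<in>X. \<Sum>b\<in>B. if b \<in> N v then 1 else 0)"
    using fin by (simp add: sum.If_cases Int_commute)
  also have "\<dots> = (\<Sum>b\<in>B. \<Sum>v\<in>X. if b \<in> N v then 1 else 0)"
    by (rule sum.swap)
  also have "\<dots> = (\<Sum>b\<in>B. \<Sum>v\<in>X. if v \<in> N b then 1 else 0)"
    using assms by (intro sum.cong refl) (use sym in auto)
  also have "\<dots> = (\<Sum>b\<in>B. int (card (N b \<inter> X)))"
    using fin by (simp add: sum.If_cases Int_commute)
  finally show ?thesis .
qed

text \<open>The triples \<open>(v, a, b)\<close> with \<open>a\<close> and \<open>b\<close> in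
  \<open>B\<close> both adjacent to \<open>v\<close>, counted by \<open>v\<close> and by
  \<open>(a, b)\<close>.\<close>

lemma sum_card_N_Int_square:
  assumes "B \<subseteq> V"
  shows "(\<Sum>v\<in>V. (int (card (N v \<inter> B)))\<^sup>2) = (\<Sum>a\<in>B. \<Sum>b\<in>B. int (card (N a \<inter> N b)))"
proof -
  have fin: "finite B" using assms finite_V finite_subset by blast
  have "(\<Sum>v\<in>V. (int (card (N v \<inter> B)))\<^sup>2)
      = (\<Sum>v\<in>V. \<Sum>a\<in>B. \<Sum>b\<in>B. if a \<in> N v \<and> b \<in> N v then 1 else 0)"
  proof (rule sum.cong[OF refl])
    fix v
    have "int (card (N v \<inter> B)) = (\<Sum>b\<in>B. if b \<in> N v then 1 else 0)"
      using fin by (simp add: sum.If_cases Int_commute)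
    then show "(int (card (N v \<inter> B)))\<^sup>2 = (\<Sum>a\<in>B. \<Sum>b\<in>B. if a \<in> N v \<and> b \<in> N v then 1 else 0)"
      by (auto simp: power2_eq_square sum_product intro!: sum.cong)
  qed
  also have "\<dots> = (\<Sum>a\<in>B. \<Sum>v\<in>V. \<Sum>b\<in>B. if a \<in> N v \<and> b \<in> N v then 1 else 0)"
    by (rule sum.swap)
  also have "\<dots> = (\<Sum>a\<in>B. \<Sum>b\<in>B. \<Sum>v\<in>V. if a \<in> N v \<and> b \<in> N v then 1 else 0)"
    by (intro sum.cong refl sum.swap)
  also have "\<dots> = (\<Sum>a\<in>B. \<Sum>b\<in>B. int (card (N a \<inter> N b)))"
  proof (intro sum.cong refl)
    fix a b assume "a \<in> B" "b \<in> B"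
    then have "{v \<in> V. a \<in> N v \<and> b \<in> N v} = N a \<inter> N b"
      using assms sym in_V by blast
    moreover have "(\<Sum>v\<in>V. if a \<in> N v \<and> b \<in> N v then 1 else 0) = int (card {v \<in> V. a \<in> N v \<and> b \<in> N v})"
      by (simp add: sum.If_cases Int_def)
    ultimately show "(\<Sum>v\<in>V. if a \<in> N v \<and> b \<in> N v then 1 else 0) = int (card (N a \<inter> N b))"
      by simp
  qed
  finally show ?thesis .
qed

text \<open>Handshake argument: a new vertex \<open>x\<close> raises the sum by twice the number of
  its neighbours in \<open>T\<close>.\<close>

lemma even_sum_degrees:
  assumes "T \<subseteq> V"
  shows "even (\<Sum>v\<in>T. card (N v \<inter> T))"
proof -
  have "finite T" using assms finite_V finite_subset by blast
  then show ?thesis using assms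
  proof (induction T)
    case (insert x T)
    have "(\<Sum>v\<in>T. card (N v \<inter> insert x T)) = (\<Sum>v\<in>T. card (N v \<inter> T) + (if v \<in> N x then 1 else 0))"
    proof (intro sum.cong refl)
      fix v assume "v \<in> T"
      then have "x \<in> N v \<longleftrightarrow> v \<in> N x" using insert.prems sym by blast
      then show "card (N v \<inter> insert x T) = card (N v \<inter> T) + (if v \<in> N x then 1 else 0)"
        using insert.hyps by auto
    qed
    also have "\<dots> = (\<Sum>v\<in>T. card (N v \<inter> T)) + card (N x \<inter> T)"
      using insert.hyps by (simp add: sum.distrib sum.If_cases Int_commute)
    finally have "(\<Sum>v\<in>insert x T. card (N v \<inter> insert x T))
        = (\<Sum>v\<in>T. card (N v \<inter> T)) + 2 * card (N x \<inter> T)"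
      using insert.hyps irrefl by simp
    then show ?case using insert by simp
  qed simp
qed

section \<open>Cocliques with 5 vertices\<close>

definition coc :: "'a set \<Rightarrow> bool" where
  "coc C \<longleftrightarrow> C \<subseteq> V \<and> card C = 5 \<and> (\<forall>a\<in>C. N a \<inter> C = {})"

lemma finite_coc: "coc C \<Longrightarrow> finite C"
  unfolding coc_def using card.infinite by fastforce

text \<open>Let \<open>d\<close> be the number of neighbours in \<open>C\<close>. The integer
  \<open>(d - 1) * (d - 2)\<close> is never negative. Its sum over \<open>V\<close> is 10 minus the
  total deficit of the common-neighbour counts below 5, and the vertices of \<open>C\<close>, where
  \<open>d = 0\<close>, already account for 10. Hence both the sum outside \<open>C\<close> and the
  deficit vanish.\<close>

lemma coc_counts:
  assumes "coc C"
  shows coc_card_N_Int: "v \<in> V \<Longrightarrow> v \<notin> C \<Longrightarrow> card (N v \<inter> C) \<in> {1, 2}"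
    and coc_common: "a \<in> C \<Longrightarrow> b \<in> C \<Longrightarrow> a \<noteq> b \<Longrightarrow> card (N a \<inter> N b) = 5"
proof -
  have CV: "C \<subseteq> V" and C5: "card C = 5" and ind: "\<And>a. a \<in> C \<Longrightarrow> N a \<inter> C = {}"
    using assms by (auto simp: coc_def)
  have fin: "finite C" using assms by (rule finite_coc)
  define d where "d v = int (card (N v \<inter> C))" for v
  define m where "m a b = int (card (N a \<inter> N b))" for a b
  have m_le: "m a b \<le> 5" if "a \<in> C" "b \<in> C - {a}" for a b
    using common_le[of a b] that CV ind[of a] by (auto simp: m_def)
  have "(\<Sum>v\<in>V. d v) = (\<Sum>b\<in>C. int (card (N b \<inter> V)))"
    unfolding d_def using sum_card_N_Int[of V C] CV by simp
  also have "\<dots> = (\<Sum>b\<in>C. 25)"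
    using CV by (intro sum.cong refl) (auto simp: card_N)
  finally have s1: "(\<Sum>v\<in>V. d v) = 125" using C5 by simp
  have "(\<Sum>v\<in>V. (d v)\<^sup>2) = (\<Sum>a\<in>C. \<Sum>b\<in>C. m a b)"
    unfolding d_def m_def using sum_card_N_Int_square[OF CV] .
  also have "\<dots> = (\<Sum>a\<in>C. m a a + (\<Sum>b\<in>C - {a}. m a b))"
    using fin by (intro sum.cong refl) (simp add: sum.remove)
  \<comment> \<open>45 = 25 + 4 * 5 is the row sum when all four other vertices of \<open>C\<close>
    attain the bound 5.\<close>
  also have "\<dots> = (\<Sum>a\<in>C. 45 - (\<Sum>b\<in>C - {a}. 5 - m a b))"
  proof (intro sum.cong refl)
    fix a assume a: "a \<in> C"
    then have "m a a = 25" using CV by (auto simp: m_def card_N)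
    then show "m a a + (\<Sum>b\<in>C - {a}. m a b) = 45 - (\<Sum>b\<in>C - {a}. 5 - m a b)"
      using a fin C5 by (simp add: sum_subtractf)
  qed
  finally have s2: "(\<Sum>v\<in>V. (d v)\<^sup>2) = 225 - (\<Sum>a\<in>C. \<Sum>b\<in>C - {a}. 5 - m a b)"
    using C5 by (simp add: sum_subtractf sum.distrib)
  have dC: "d v = 0" if "v \<in> C" for v using ind[OF that] by (simp add: d_def)
  have "(\<Sum>v\<in>V. (d v - 1) * (d v - 2)) = (\<Sum>v\<in>V. (d v)\<^sup>2 - 3 * d v + 2)"
    by (simp add: algebra_simps power2_eq_square)
  \<comment> \<open>10 = 225 - 3 * 125 + 2 * 80.\<close>
  also have "\<dots> = 10 - (\<Sum>a\<in>C. \<Sum>b\<in>C - {a}. 5 - m a b)"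
    using s1 s2 card_V by (simp add: sum.distrib sum_subtractf flip: sum_distrib_left)
  finally have "(\<Sum>v\<in>V. (d v - 1) * (d v - 2)) = 10 - (\<Sum>a\<in>C. \<Sum>b\<in>C - {a}. 5 - m a b)" .
  moreover have "(\<Sum>v\<in>V. (d v - 1) * (d v - 2)) = (\<Sum>v\<in>V - C. (d v - 1) * (d v - 2)) + 10"
    using CV C5 dC by (simp add: sum.subset_diff[OF CV])
  ultimately have eq: "(\<Sum>v\<in>V - C. (d v - 1) * (d v - 2)) + (\<Sum>a\<in>C. \<Sum>b\<in>C - {a}. 5 - m a b) = 0"
    by linarith
  have nn: "(d v - 1) * (d v - 2) \<ge> 0" for v
  proof (cases "d v \<le> 1")
    case True then show ?thesis by (intro mult_nonpos_nonpos) auto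
  next
    case False then show ?thesis by (intro mult_nonneg_nonneg) auto
  qed
  have nn2: "(\<Sum>b\<in>C - {a}. 5 - m a b) \<ge> 0" if "a \<in> C" for a
    using m_le[OF that] by (intro sum_nonneg) simp
  have z1: "(\<Sum>v\<in>V - C. (d v - 1) * (d v - 2)) = 0"
    and z2: "(\<Sum>a\<in>C. \<Sum>b\<in>C - {a}. 5 - m a b) = 0"
    using eq sum_nonneg[of "V - C" "\<lambda>v. (d v - 1) * (d v - 2)", OF nn]
      sum_nonneg[of C "\<lambda>a. \<Sum>b\<in>C - {a}. 5 - m a b", OF nn2] by linarith+
  show "card (N v \<inter> C) \<in> {1, 2}" if "v \<in> V" "v \<notin> C"
  proof -
    have "(d v - 1) * (d v - 2) = 0"
      using z1 nn that by (subst (asm) sum_nonneg_eq_0_iff) auto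
    then show ?thesis by (auto simp: d_def)
  qed
  show "card (N a \<inter> N b) = 5" if "a \<in> C" "b \<in> C" "a \<noteq> b"
  proof -
    have "(\<Sum>b\<in>C - {a}. 5 - m a b) = 0"
      using z2 nn2 fin that by (subst (asm) sum_nonneg_eq_0_iff) auto
    then have "5 - m a b = 0"
      using m_le[OF that(1)] fin that by (subst (asm) sum_nonneg_eq_0_iff) auto
    then show ?thesis by (simp add: m_def)
  qed
qed

section \<open>Extending cocliques and exchanging their vertices\<close>

text \<open>For a coclique \<open>B\<close>, these are the vertices that extend it to a larger
  coclique. If \<open>B\<close> lies in a coclique \<open>C\<close>, then \<open>C - B\<close> is
  among them.\<close>

definition rest :: "'a set \<Rightarrow> 'a set" where
  "rest B = {v \<in> V - B. N v \<inter> B = {}}"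

lemma rest_anti: "B \<subseteq> D \<Longrightarrow> rest D \<subseteq> rest B"
  by (auto simp: rest_def)

lemma finite_rest [simp]: "finite (rest B)"
  by (simp add: rest_def)

text \<open>The upper bound 2 of \<open>coc_card_N_Int\<close>, in the form that refutes cocliques
  built by exchange.\<close>

lemma coc_not_three:
  assumes "coc C" "{a, b, c} \<subseteq> C" "a \<noteq> b" "a \<noteq> c" "b \<noteq> c" "{a, b, c} \<subseteq> N v" "v \<in> V"
  shows False
proof -
  have "v \<notin> C" using assms by (auto simp: coc_def)
  then have "card (N v \<inter> C) \<le> 2" using coc_card_N_Int[of C v] assms by auto
  moreover have "card {a, b, c} \<le> card (N v \<inter> C)"
    using assms by (intro card_mono) auto
  ultimately show False using assms by simp
qed

text \<open>An exchange yields a new 5-coclique, to which \<open>coc_counts\<close> applies in turn;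
  this gives access to vertices outside \<open>C\<close>.\<close>

lemma coc_swap:
  assumes "coc C" "c \<in> C" "u \<in> rest (C - {c})"
  shows "coc (insert u (C - {c}))"
proof -
  have "card (insert u (C - {c})) = 5"
    using assms finite_coc[OF assms(1)] by (auto simp: rest_def coc_def)
  moreover have "u \<notin> N a" if "a \<in> C - {c}" for a
    using assms that sym[of u a] by (auto simp: rest_def coc_def)
  ultimately show ?thesis
    using assms irrefl[of u] by (auto simp: rest_def coc_def)
qed

lemma coc_swap2:
  assumes "coc C" "c \<in> C" "c' \<in> C" "c \<noteq> c'" "B = C - {c, c'}"
    and "y \<in> rest B" "z \<in> rest B" "y \<noteq> z" "z \<notin> N y"
  shows "coc (insert y (insert z B))"
proof -
  have "card B = 3"
    using assms finite_coc[OF assms(1)] by (simp add: coc_def card_Diff_subset)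
  then have "card (insert y (insert z B)) = 5"
    using assms finite_coc[OF assms(1)] by (auto simp: rest_def)
  moreover have "y \<notin> N a" "z \<notin> N a" if "a \<in> B" for a
    using assms that sym[of y a] sym[of z a] by (auto simp: rest_def coc_def)
  moreover have "y \<notin> N z" using assms sym[of y z] by (auto simp: rest_def)
  ultimately show ?thesis
    using assms irrefl[of y] irrefl[of z] by (auto simp: rest_def coc_def)
qed

text \<open>Again \<open>(d - 1) * (d - 2)\<close> is summed, now with \<open>d\<close> the number
  of neighbours in \<open>B\<close>. It is 2 where \<open>d = 0\<close>, that is on \<open>B\<close>
  and \<open>rest B\<close>, and 0 elsewhere, since \<open>d \<le> 2\<close> is inherited from
  \<open>C\<close>. Undoubled, the formula is 80 - 26 k + 5 (k choose 2), giving 33, 17 and 6 for k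
  = 2, 3 and 4.\<close>

lemma card_rest:
  assumes "coc C" "B \<subseteq> C" "card B = k"
  shows "2 * int (card (rest B)) = 160 - 52 * int k + 5 * int k * (int k - 1)"
proof -
  have CV: "C \<subseteq> V" and ind: "\<And>a. a \<in> C \<Longrightarrow> N a \<inter> C = {}"
    using assms by (auto simp: coc_def)
  have BV: "B \<subseteq> V" using assms CV by auto
  have fin: "finite B" using assms finite_coc finite_subset by blast
  define d where "d v = int (card (N v \<inter> B))" for v
  have "(\<Sum>v\<in>V. d v) = (\<Sum>b\<in>B. int (card (N b \<inter> V)))"
    unfolding d_def using sum_card_N_Int[of V B] BV by simp
  also have "\<dots> = (\<Sum>b\<in>B. 25)"
    using BV by (intro sum.cong refl) (auto simp: card_N)
  finally have s1: "(\<Sum>v\<in>V. d v) = 25 * int k" using assms by simp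
  have "(\<Sum>v\<in>V. (d v)\<^sup>2) = (\<Sum>a\<in>B. \<Sum>b\<in>B. int (card (N a \<inter> N b)))"
    unfolding d_def using sum_card_N_Int_square[OF BV] .
  also have "\<dots> = (\<Sum>a\<in>B. 25 + 5 * (int k - 1))"
  proof (intro sum.cong refl)
    fix a assume a: "a \<in> B"
    have "(\<Sum>b\<in>B. int (card (N a \<inter> N b))) = int (card (N a \<inter> N a)) + (\<Sum>b\<in>B - {a}. int (card (N a \<inter> N b)))"
      using fin a by (simp add: sum.remove)
    also have "(\<Sum>b\<in>B - {a}. int (card (N a \<inter> N b))) = (\<Sum>b\<in>B - {a}. 5)"
      using coc_common[OF assms(1), of a] a assms(2) by (intro sum.cong refl) auto
    finally have "(\<Sum>b\<in>B. int (card (N a \<inter> N b))) = int (card (N a)) + 5 * int (card (B - {a}))"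
      by simp
    moreover have "int (card (B - {a})) = int k - 1"
    proof -
      have "card B > 0" using a fin card_gt_0_iff by blast
      then show ?thesis using a fin assms(3) by (simp add: of_nat_diff)
    qed
    moreover have "card (N a) = 25" using a BV by (auto simp: card_N)
    ultimately show "(\<Sum>b\<in>B. int (card (N a \<inter> N b))) = 25 + 5 * (int k - 1)"
      by simp
  qed
  finally have s2: "(\<Sum>v\<in>V. (d v)\<^sup>2) = int k * (25 + 5 * (int k - 1))"
    using assms by simp
  have "(\<Sum>v\<in>V. (d v)\<^sup>2 - 3 * d v + 2) = (\<Sum>v\<in>V. if v \<in> B \<union> rest B then 2 else 0)"
  proof (intro sum.cong refl)
    fix v assume v: "v \<in> V"
    have "v \<in> B \<union> rest B \<longleftrightarrow> N v \<inter> B = {}"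
      using v ind[of v] assms(2) by (auto simp: rest_def)
    also have "\<dots> \<longleftrightarrow> d v = 0" using fin by (simp add: d_def)
    finally have iff: "v \<in> B \<union> rest B \<longleftrightarrow> d v = 0" .
    have "card (N v \<inter> C) \<le> 2"
      using coc_card_N_Int[OF assms(1) v] ind[of v] by (cases "v \<in> C") auto
    moreover have "card (N v \<inter> B) \<le> card (N v \<inter> C)"
      using assms(2) by (intro card_mono) auto
    ultimately have "d v = 0 \<or> d v = 1 \<or> d v = 2" unfolding d_def by linarith
    then show "(d v)\<^sup>2 - 3 * d v + 2 = (if v \<in> B \<union> rest B then 2 else 0)"
      using iff by auto
  qed
  also have "\<dots> = 2 * int (card (B \<union> rest B))"
  proof -
    have "V \<inter> (B \<union> rest B) = B \<union> rest B" using BV by (auto simp: rest_def)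
    then show ?thesis by (simp add: sum.If_cases del: Un_iff)
  qed
  also have "card (B \<union> rest B) = k + card (rest B)"
    using fin assms(3) by (subst card_Un_disjoint) (auto simp: rest_def)
  finally have "(\<Sum>v\<in>V. (d v)\<^sup>2 - 3 * d v + 2) = 2 * int k + 2 * int (card (rest B))"
    by simp
  moreover have "(\<Sum>v\<in>V. (d v)\<^sup>2 - 3 * d v + 2) = int k * (25 + 5 * (int k - 1)) - 3 * (25 * int k) + 160"
    using s1 s2 card_V by (simp add: sum.distrib sum_subtractf flip: sum_distrib_left)
  ultimately show ?thesis by (simp add: algebra_simps)
qed

text \<open>A non-neighbour \<open>z\<close> of \<open>y\<close> in \<open>rest B\<close> completes
  \<open>B\<close> and \<open>y\<close> to a 5-coclique. Then \<open>y\<close> shares 5 neighbours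
  with each of the three vertices of \<open>B\<close>, and these 15 are distinct, as a neighbour of
  \<open>y\<close> has at most one more neighbour in the coclique. So 25 - 15 = 10 neighbours of
  \<open>y\<close> lie in \<open>rest B\<close>. If there is no such \<open>z\<close>, then
  \<open>y\<close> is adjacent to the other 16 vertices of \<open>rest B\<close>.\<close>

lemma card_N_Int_rest:
  assumes "coc C" "c \<in> C" "c' \<in> C" "c \<noteq> c'" "B = C - {c, c'}" "y \<in> rest B"
  shows card_N_Int_rest_nonadj: "z \<in> rest B \<Longrightarrow> z \<noteq> y \<Longrightarrow> z \<notin> N y \<Longrightarrow> card (N y \<inter> rest B) = 10"
    and card_N_Int_rest_cases: "card (N y \<inter> rest B) \<in> {10, 16}"
proof -
  have B3: "card B = 3"
    using assms finite_coc[OF assms(1)] by (simp add: coc_def card_Diff_subset)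
  have fin: "finite B" using assms finite_coc by blast
  have BV: "B \<subseteq> V" using assms by (auto simp: coc_def)
  have yV: "y \<in> V" and yB: "y \<notin> B" "N y \<inter> B = {}" using assms by (auto simp: rest_def)
  show *: "card (N y \<inter> rest B) = 10" if z: "z \<in> rest B" "z \<noteq> y" "z \<notin> N y" for z
  proof -
    define D where "D = insert y (insert z B)"
    have D: "coc D" unfolding D_def using coc_swap2[OF assms(1-6) z(1)] z by auto
    have "(\<Sum>v\<in>N y. int (card (N v \<inter> B))) = (\<Sum>b\<in>B. int (card (N b \<inter> N y)))"
      by (intro sum_card_N_Int N_V BV)
    also have "\<dots> = (\<Sum>b\<in>B. 5)"
      using coc_common[OF D, of _ y] yB by (intro sum.cong refl) (auto simp: D_def)
    finally have s: "(\<Sum>v\<in>N y. int (card (N v \<inter> B))) = 15" using B3 by simp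
    have "(\<Sum>v\<in>N y. int (card (N v \<inter> B))) = (\<Sum>v\<in>N y. if v \<in> rest B then 0 else 1)"
    proof (intro sum.cong refl)
      fix v assume v: "v \<in> N y"
      then have vV: "v \<in> V" and yv: "y \<in> N v" using in_V sym yV by blast+
      have "v \<notin> D" using v D by (auto simp: coc_def D_def)
      then have "card (N v \<inter> D) \<le> 2" using coc_card_N_Int[OF D vV] by auto
      moreover have "card (insert y (N v \<inter> B)) \<le> card (N v \<inter> D)"
        using yv by (intro card_mono) (auto simp: D_def)
      ultimately have "card (N v \<inter> B) \<le> 1" using yB by simp
      moreover have "v \<in> rest B \<longleftrightarrow> card (N v \<inter> B) = 0"
        using \<open>v \<notin> D\<close> vV by (auto simp: D_def rest_def)
      ultimately show "int (card (N v \<inter> B)) = (if v \<in> rest B then 0 else 1)"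
        by (simp del: card_eq_0_iff card_0_eq)
    qed
    also have "\<dots> = int (card (N y - rest B))"
      by (simp add: sum.If_cases Diff_eq)
    finally have "card (N y - rest B) = 15" using s by simp
    then show ?thesis
      using card_N[OF yV] card_Diff_subset_Int[of "N y" "rest B"] card_mono[of "N y" "N y \<inter> rest B"]
      by simp
  qed
  show "card (N y \<inter> rest B) \<in> {10, 16}"
  proof (cases "\<exists>z \<in> rest B. z \<noteq> y \<and> z \<notin> N y")
    case True
    then show ?thesis using * by auto
  next
    case False
    then have "N y \<inter> rest B = rest B - {y}" using irrefl by auto
    moreover have "card (rest B) = 17"
      using card_rest[OF assms(1) _ B3] assms(5) by auto
    ultimately show ?thesis using assms(6) by simp
  qed
qed

text \<open>The key step. If \<open>w\<close> has two neighbours \<open>c1\<close>, \<open>c2\<close> in the coclique and lies in no coclique of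
  size 5 together with \<open>c\<close>, then \<open>w\<close> dominates \<open>rest (C - {c1, c2})\<close>, and \<open>N w\<close> splits each of the
  17-sets \<open>rest (C - {c1, c3})\<close> and \<open>rest (C - {c2, c3})\<close> into two cliques, the one inside \<open>N w\<close>
  having at least 9 elements. This forces too many common neighbours of \<open>w\<close> and \<open>c3\<close>.\<close>

lemma card_common_rest_ge:
  assumes C: "coc C" and w: "w \<in> V" "w \<notin> C"
    and c: "c \<in> C" "c \<notin> N w"
    and none: "\<And>D. coc D \<Longrightarrow> w \<in> D \<Longrightarrow> c \<in> D \<Longrightarrow> False"
    and ci: "ci \<in> C" "cj \<in> C" "ci \<noteq> cj" "N w \<inter> C = {ci, cj}"
    and c3: "c3 \<in> C" "c3 \<notin> N w" "c3 \<noteq> c"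
  shows "card (N w \<inter> rest (C - {ci, c3}) \<inter> N c3) \<ge> 3"
proof -
  define D where "D = C - {ci, c3}"
  define S where "S = rest D"
  define L where "L = S \<inter> N w"
  define R where "R = S - N w"
  \<comment> \<open>The six vertices that can stand in for \<open>ci\<close> in \<open>C\<close>,
    \<open>ci\<close> itself included.\<close>
  define Q where "Q = rest (C - {ci})"
  have CV: "C \<subseteq> V" and C5: "card C = 5"
    using C by (auto simp: coc_def)
  have finC: "finite C" using C by (rule finite_coc)
  have ci3: "ci \<noteq> c3" "cj \<noteq> c3" using ci c3 by auto
  have cw: "ci \<in> N w" "cj \<in> N w" using ci by auto
  have wN: "w \<in> N ci" "w \<in> N cj" using cw ci w CV sym by blast+
  have cD: "c \<in> D" "cj \<in> D" using c c3 ci ci3 cw by (auto simp: D_def)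
  have NwD: "N w \<inter> D = {cj}" using ci ci3 by (auto simp: D_def)
  have D3: "card D = 3" using C5 finC ci3 ci c3 by (simp add: D_def card_Diff_subset)
  have S17: "card S = 17" using card_rest[OF C _ D3] by (auto simp: S_def D_def)
  have "card (C - {ci}) = 4" using C5 finC ci by simp
  then have Q6: "card Q = 6" using card_rest[OF C, of "C - {ci}" 4] by (auto simp: Q_def)
  have cocD: "coc (insert y (insert z D))" if "y \<in> S" "z \<in> S" "y \<noteq> z" "z \<notin> N y" for y z
    using coc_swap2[OF C ci(1) c3(1) ci3(1) D_def] that by (auto simp: S_def)
  have wS: "w \<notin> S" using wN sym w cw cD by (auto simp: S_def rest_def)
  \<comment> \<open>Otherwise replacing \<open>ci\<close> and \<open>cj\<close> by \<open>w\<close>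
    and \<open>z\<close> gives a 5-coclique containing \<open>w\<close> and \<open>c\<close>,
    against \<open>none\<close>.\<close>
  have dominated: "z \<in> N w" if z: "z \<in> rest (C - {ci, cj})" "z \<noteq> w" for z
  proof (rule ccontr)
    assume zw: "z \<notin> N w"
    have "w \<in> rest (C - {ci, cj})" using w ci by (auto simp: rest_def)
    then have "coc (insert w (insert z (C - {ci, cj})))"
      using coc_swap2[OF C ci(1,2,3) refl, of w z] z zw by auto
    then show False using none c ci by auto
  qed
  have QN: "Q \<subseteq> N w"
  proof
    fix q assume q: "q \<in> Q"
    then have "q \<noteq> w" using ci by (auto simp: Q_def rest_def)
    moreover have "q \<in> rest (C - {ci, cj})" using q rest_anti[of "C - {ci, cj}" "C - {ci}"]
      by (auto simp: Q_def)
    ultimately show "q \<in> N w" by (rule dominated[rotated])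
  qed
  have QS: "Q \<subseteq> S" using rest_anti[of D "C - {ci}"] by (auto simp: Q_def S_def D_def)
  \<comment> \<open>Otherwise \<open>D'\<close> is a 5-coclique in which \<open>cj\<close> is the
    only neighbour of \<open>w\<close>; replacing \<open>cj\<close> by \<open>w\<close> keeps
    \<open>c\<close>, against \<open>none\<close>.\<close>
  have R_clique: "z \<in> N y" if "y \<in> R" "z \<in> R" "y \<noteq> z" for y z
  proof (rule ccontr)
    assume zy: "z \<notin> N y"
    define D' where "D' = insert y (insert z D)"
    have D': "coc D'" using cocD that zy by (auto simp: D'_def R_def)
    have "N w \<inter> D' = {cj}" using NwD that by (auto simp: D'_def R_def)
    moreover have "w \<notin> D'" using wS that w by (auto simp: D'_def R_def D_def)
    ultimately have "w \<in> rest (D' - {cj})" using w by (auto simp: rest_def)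
    then have "coc (insert w (D' - {cj}))"
      using coc_swap[OF D', of cj w] cD by (auto simp: D'_def)
    then show False using none[of "insert w (D' - {cj})"] cD c ci by (auto simp: D'_def)
  qed
  \<comment> \<open>Otherwise \<open>w\<close> has three neighbours \<open>y\<close>,
    \<open>z\<close>, \<open>cj\<close> in a 5-coclique.\<close>
  have L_clique: "z \<in> N y" if "y \<in> L" "z \<in> L" "y \<noteq> z" for y z
  proof (rule ccontr)
    assume zy: "z \<notin> N y"
    have "coc (insert y (insert z D))" using cocD that zy by (auto simp: L_def)
    moreover have "cj \<notin> S" using cD by (auto simp: S_def rest_def)
    ultimately show False
      using coc_not_three[of "insert y (insert z D)" y z cj w] that cD cw w by (auto simp: L_def)
  qed
  have deg_cases: "card (N y \<inter> S) \<in> {10, 16}" if "y \<in> S" for y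
    using card_N_Int_rest_cases[OF C ci(1) c3(1) ci3(1) D_def] that by (simp add: S_def)
  \<comment> \<open>If \<open>r\<close> were adjacent to all other vertices of \<open>S\<close>, it
    would share the six vertices of \<open>Q\<close> with its non-neighbour \<open>w\<close>, one
    more than \<open>common_le\<close> allows.\<close>
  have deg_R: "card (N r \<inter> S) = 10" if r: "r \<in> R" for r
  proof -
    have "\<exists>z\<in>S. z \<noteq> r \<and> z \<notin> N r"
    proof (rule ccontr)
      assume "\<not> ?thesis"
      moreover have "r \<notin> Q" using r QN by (auto simp: R_def)
      ultimately have "Q \<subseteq> N w \<inter> N r" using QS QN by auto
      then have "6 \<le> card (N w \<inter> N r)" using Q6 card_mono[of "N w \<inter> N r" Q] by simp
      moreover have "card (N w \<inter> N r) \<le> 5"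
        using common_le[of w r] w r wS by (auto simp: R_def S_def rest_def)
      ultimately show False by simp
    qed
    then show ?thesis
      using card_N_Int_rest_nonadj[OF C ci(1) c3(1) ci3(1) D_def] r by (auto simp: S_def R_def)
  qed
  have finS: "finite S" by (simp add: S_def)
  have finL: "finite L" "finite R" using finS by (auto simp: L_def R_def)
  have SLR: "S = L \<union> R" "L \<inter> R = {}" by (auto simp: L_def R_def)
  have LR: "card L + card R = 17" using S17 SLR finL by (simp add: card_Un_disjoint)
  have degs: "int (card (N y \<inter> S)) = int (card A) - 1 + int (card (N y \<inter> B))"
    if "y \<in> A" "finite A" "finite B" "S = A \<union> B" "A \<inter> B = {}" "\<And>z. z \<in> A \<Longrightarrow> y \<noteq> z \<Longrightarrow> z \<in> N y" for y A B
  proof -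
    have "N y \<inter> S = (A - {y}) \<union> (N y \<inter> B)" using that irrefl by auto
    then have "card (N y \<inter> S) = card (A - {y}) + card (N y \<inter> B)"
      using that by (simp only:) (subst card_Un_disjoint, auto)
    moreover have "card A > 0" using that card_gt_0_iff by blast
    ultimately show ?thesis using that by (simp add: of_nat_diff)
  qed
  have SV: "S \<subseteq> V" by (auto simp: S_def rest_def)
  \<comment> \<open>Edges between the cliques \<open>L\<close> and \<open>R\<close>, counted from
    both ends: each vertex of \<open>R\<close> sends exactly \<open>11 - card R\<close>, each vertex
    of \<open>L\<close> at least \<open>11 - card L\<close>.\<close>
  have "(\<Sum>r\<in>R. int (card (N r \<inter> L))) = (\<Sum>l\<in>L. int (card (N l \<inter> R)))"
    by (intro sum_card_N_Int) (use SV SLR in auto)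
  moreover have "(\<Sum>r\<in>R. int (card (N r \<inter> L))) = (\<Sum>r\<in>R. 11 - int (card R))"
  proof (intro sum.cong refl)
    fix r assume r: "r \<in> R"
    show "int (card (N r \<inter> L)) = 11 - int (card R)"
      using degs[of r R L] deg_R[OF r] r finL SLR R_clique by (simp add: Un_commute Int_commute)
  qed
  moreover have "(\<Sum>l\<in>L. int (card (N l \<inter> R))) \<ge> (\<Sum>l\<in>L. 11 - int (card L))"
  proof (intro sum_mono)
    fix l assume l: "l \<in> L"
    have "card (N l \<inter> S) \<ge> 10" using deg_cases[of l] l by (auto simp: L_def)
    then show "int (card (N l \<inter> R)) \<ge> 11 - int (card L)"
      using degs[of l L R] l finL SLR L_clique by simp
  qed
  ultimately have "int (card R) * (11 - int (card R)) \<ge> int (card L) * (11 - int (card L))"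
    by simp
  moreover have "int (card R) = 17 - int (card L)" using LR by simp
  \<comment> \<open>After substituting for \<open>card R\<close>, the inequality becomes
    \<open>12 * card L \<ge> 102\<close>.\<close>
  ultimately have "card L \<ge> 9" by (simp add: algebra_simps)
  \<comment> \<open>A vertex of \<open>S\<close> that is neither \<open>c3\<close> nor adjacent to
    it extends \<open>D\<close> together with \<open>c3\<close>, which is \<open>C - {ci}\<close>.
    So at least 9 - 6 = 3 vertices of \<open>L\<close> are adjacent to \<open>c3\<close>.\<close>
  moreover have "L - N c3 \<subseteq> Q"
  proof
    fix v assume v: "v \<in> L - N c3"
    then have "c3 \<notin> N v" using c3 CV sym[of c3 v] SV by (auto simp: L_def)
    moreover have "v \<noteq> c3" using v c3 by (auto simp: L_def)
    ultimately show "v \<in> Q" using v by (auto simp: L_def S_def Q_def D_def rest_def)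
  qed
  then have "card (L - N c3) \<le> 6" using Q6 card_mono[of Q "L - N c3"] by (simp add: Q_def)
  moreover have "card L = card (L \<inter> N c3) + card (L - N c3)"
    using finL card_Int_Diff by blast
  moreover have "L \<inter> N c3 = N w \<inter> rest (C - {ci, c3}) \<inter> N c3"
    by (auto simp: L_def S_def D_def)
  ultimately show ?thesis by simp
qed

text \<open>If the count is not 5, \<open>coc_common\<close> forbids every 5-coclique containing
  \<open>w\<close> and \<open>c\<close>. If \<open>w\<close> has one neighbour in \<open>C\<close>,
  it can replace that neighbour, giving such a coclique. If it has two,
  \<open>card_common_rest_ge\<close> applied to each of them gives two disjoint sets of at least 3
  common neighbours of \<open>w\<close> and a further vertex \<open>c3\<close>, too many for
  \<open>common_le\<close>.\<close>

lemma coc_common_all: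
  assumes C: "coc C" and w: "w \<in> V" "w \<notin> C" and c: "c \<in> C" "c \<notin> N w"
  shows "card (N w \<inter> N c) = 5"
proof (rule ccontr)
  assume neq: "card (N w \<inter> N c) \<noteq> 5"
  have none: False if "coc D" "w \<in> D" "c \<in> D" for D
    using coc_common[OF that] neq w c by auto
  have CV: "C \<subseteq> V" and C5: "card C = 5"
    using C by (auto simp: coc_def)
  have finC: "finite C" using C by (rule finite_coc)
  consider "card (N w \<inter> C) = 1" | "card (N w \<inter> C) = 2"
    using coc_card_N_Int[OF C w] by auto
  then show False
  proof cases
    case 1
    then obtain c1 where c1: "N w \<inter> C = {c1}" by (auto simp: card_1_singleton_iff)
    then have "w \<in> rest (C - {c1})" using w by (auto simp: rest_def)
    then have "coc (insert w (C - {c1}))" using coc_swap[OF C, of c1] c1 by auto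
    then show False using none[of "insert w (C - {c1})"] c c1 by auto
  next
    case 2
    then obtain c1 c2 where c12: "N w \<inter> C = {c1, c2}" "c1 \<noteq> c2" by (auto simp: card_2_iff)
    then have mem: "c1 \<in> C" "c2 \<in> C" by auto
    have "card {c1, c2, c} \<le> 3" by (simp add: card_insert_if)
    then have "C - {c1, c2, c} \<noteq> {}"
      using C5 finC card_mono[of "{c1, c2, c}" C] by auto
    then obtain c3 where c3: "c3 \<in> C" "c3 \<noteq> c1" "c3 \<noteq> c2" "c3 \<noteq> c" by auto
    have c3w: "c3 \<notin> N w" using c3 c12 by auto
    let ?A = "\<lambda>ci. N w \<inter> rest (C - {ci, c3}) \<inter> N c3"
    have "card (?A c1) \<ge> 3"
      by (rule card_common_rest_ge[OF C w c none mem c12(2,1) c3(1) c3w c3(4)])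
    moreover have "card (?A c2) \<ge> 3"
      by (rule card_common_rest_ge[OF C w c none mem(2,1) c12(2)[symmetric] _ c3(1) c3w c3(4)])
        (use c12 in auto)
    \<comment> \<open>A shared vertex \<open>v\<close> could replace \<open>c3\<close> in
      \<open>C\<close>, and \<open>w\<close> would then have the neighbours \<open>v\<close>,
      \<open>c1\<close>, \<open>c2\<close> in a 5-coclique.\<close>
    moreover have "?A c1 \<inter> ?A c2 = {}"
    proof (rule ccontr)
      assume "\<not> ?thesis"
      then obtain v where v: "v \<in> N w" "v \<in> rest (C - {c1, c3})" "v \<in> rest (C - {c2, c3})" by auto
      then have "v \<in> rest (C - {c3})" using c12 c3 mem by (auto simp: rest_def)
      moreover have "v \<noteq> c1" "v \<noteq> c2" using v c12 c3 mem by (auto simp: rest_def)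
      ultimately show False
        using coc_not_three[OF coc_swap[OF C c3(1)], of v v c1 c2 w] c12 c3 mem v w by auto
    qed
    ultimately have "card (?A c1 \<union> ?A c2) \<ge> 6"
      by (subst card_Un_disjoint) auto
    moreover have "card (?A c1 \<union> ?A c2) \<le> card (N w \<inter> N c3)"
      by (intro card_mono) auto
    moreover have "card (N w \<inter> N c3) \<le> 5"
      using common_le[of w c3] w c3 c3w CV by auto
    ultimately show False by simp
  qed
qed

section \<open>The parity contradiction\<close>

text \<open>With \<open>B = C - {c, d}\<close>, the vertex \<open>p\<close> shares 5 neighbours with
  each vertex of \<open>B\<close>. The resulting 15 pairs also number
  \<open>card (N p - rest B) + card (N p \<inter> rest {c, d})\<close>. The first summand is 25 - 10
  or 25 - 16, so the second is 0 or 6.\<close>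

lemma card_N_Int_rest_even:
  assumes C: "coc C" and cd: "c \<in> C" "d \<in> C" "c \<noteq> d" and p: "p \<in> N c \<inter> N d"
  shows "even (card (N p \<inter> rest {c, d}))"
proof -
  define B where "B = C - {c, d}"
  have CV: "C \<subseteq> V" and C5: "card C = 5" and ind: "\<And>a. a \<in> C \<Longrightarrow> N a \<inter> C = {}"
    using C by (auto simp: coc_def)
  have finC: "finite C" using C by (rule finite_coc)
  have finB: "finite B" and BV: "B \<subseteq> V" using finC CV by (auto simp: B_def)
  have B3: "card B = 3" using C5 finC cd by (simp add: B_def card_Diff_subset)
  have pV: "p \<in> V" and pC: "p \<notin> C" using p in_V ind cd by auto
  have cdp: "c \<in> N p" "d \<in> N p" using p pV cd CV sym by blast+
  have pB: "N p \<inter> B = {}"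
  proof (rule ccontr)
    assume "N p \<inter> B \<noteq> {}"
    then obtain b where "b \<in> N p" "b \<in> B" by auto
    then show False using coc_not_three[OF C, of c d b p] cd cdp pV by (auto simp: B_def)
  qed
  have pS: "p \<in> rest B" using pV pC pB by (auto simp: rest_def B_def)
  have "(\<Sum>v\<in>N p. int (card (N v \<inter> B))) = (\<Sum>b\<in>B. int (card (N b \<inter> N p)))"
    by (intro sum_card_N_Int N_V BV)
  also have "\<dots> = (\<Sum>b\<in>B. 5)"
  proof (intro sum.cong refl)
    fix b assume "b \<in> B"
    then show "int (card (N b \<inter> N p)) = 5"
      using coc_common_all[OF C pV pC, of b] pB by (auto simp: B_def Int_commute)
  qed
  finally have s: "(\<Sum>v\<in>N p. int (card (N v \<inter> B))) = 15" using B3 by simp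
  \<comment> \<open>If \<open>v\<close> lies outside \<open>C\<close>, with i neighbours in
    \<open>B\<close> and j in \<open>{c, d}\<close>, then (i, j) is (0, 1), (0, 2), (1, 1) or (2,
    0). In each case i is the number of true statements among i > 0 and j = 0.\<close>
  have "(\<Sum>v\<in>N p. int (card (N v \<inter> B)))
      = (\<Sum>v\<in>N p. (if v \<in> rest B then 0 else 1) + (if v \<in> rest {c, d} then 1 else 0))"
  proof (intro sum.cong refl)
    fix v assume v: "v \<in> N p"
    then have vV: "v \<in> V" and pv: "p \<in> N v" using in_V sym pV by blast+
    show "int (card (N v \<inter> B)) = (if v \<in> rest B then 0 else 1) + (if v \<in> rest {c, d} then 1 else 0)"
    proof (cases "v \<in> C")
      case True
      then have "v \<in> {c, d}" using v pB by (auto simp: B_def)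
      moreover have "N v \<inter> B = {}" using ind[OF True] by (auto simp: B_def)
      ultimately show ?thesis using vV by (auto simp: rest_def B_def)
    next
      case False
      have "N v \<inter> C = (N v \<inter> B) \<union> (N v \<inter> {c, d})" using cd by (auto simp: B_def)
      then have "card (N v \<inter> C) = card (N v \<inter> B) + card (N v \<inter> {c, d})"
        by (simp only:) (subst card_Un_disjoint, auto simp: B_def)
      then have sum: "card (N v \<inter> B) + card (N v \<inter> {c, d}) \<in> {1, 2}"
        using coc_card_N_Int[OF C vV False] by simp
      have S: "v \<in> rest B \<longleftrightarrow> card (N v \<inter> B) = 0"
        using False vV by (auto simp: rest_def B_def)
      have T: "v \<in> rest {c, d} \<longleftrightarrow> card (N v \<inter> {c, d}) = 0"
        using False vV cd by (auto simp: rest_def)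
      \<comment> \<open>If \<open>b\<close> were the only neighbour of \<open>v\<close> in
        \<open>C\<close>, exchanging \<open>b\<close> for \<open>v\<close> would give
        \<open>p\<close> the neighbours \<open>v\<close>, \<open>c\<close>, \<open>d\<close> in a
        5-coclique.\<close>
      have "card (N v \<inter> {c, d}) \<noteq> 0" if one: "card (N v \<inter> B) = 1"
      proof
        assume 0: "card (N v \<inter> {c, d}) = 0"
        obtain b where b: "N v \<inter> B = {b}" using one by (rule card_1_singletonE)
        have "v \<in> rest (C - {b})" using b 0 False vV by (auto simp: rest_def B_def)
        then have "coc (insert v (C - {b}))" using coc_swap[OF C, of b] b by (auto simp: B_def)
        moreover have "c \<noteq> b" "d \<noteq> b" using b by (auto simp: B_def)
        ultimately show False
          using coc_not_three[of "insert v (C - {b})" v c d p] cd cdp pV v False by auto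
      qed
      then show ?thesis using sum unfolding S T by (simp del: card_eq_0_iff card_0_eq) linarith
    qed
  qed
  also have "\<dots> = int (card (N p - rest B)) + int (card (N p \<inter> rest {c, d}))"
    by (simp add: sum.distrib sum.If_cases Diff_eq)
  finally have "card (N p - rest B) + card (N p \<inter> rest {c, d}) = 15" using s by linarith
  moreover have "card (N p \<inter> rest B) + card (N p - rest B) = 25"
    using card_N[OF pV] card_Int_Diff[of "N p" "rest B"] by simp
  moreover have "card (N p \<inter> rest B) \<in> {10, 16}"
    by (rule card_N_Int_rest_cases[OF C cd B_def pS])
  ultimately have "card (N p \<inter> rest {c, d}) \<in> {0, 6}" by auto
  then show ?thesis by auto
qed

lemma no_coc: "\<not> coc C"
proof
  assume C: "coc C"
  have CV: "C \<subseteq> V" and C5: "card C = 5"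
    using C by (auto simp: coc_def)
  have "\<exists>c d. c \<in> C \<and> d \<in> C \<and> c \<noteq> d"
    using C5 card_le_Suc0_iff_eq[OF finite_coc[OF C]] by auto
  then obtain c d where cd: "c \<in> C" "d \<in> C" "c \<noteq> d" by auto
  define T where "T = rest {c, d}"
  define P where "P = N c \<inter> N d"
  have TV: "T \<subseteq> V" and PV: "P \<subseteq> V" using in_V by (auto simp: T_def rest_def P_def)
  have T33: "card T = 33" using card_rest[OF C, of "{c, d}" 2] cd by (simp add: T_def)
  \<comment> \<open>\<open>T\<close> contains the three other vertices of \<open>C\<close>;
    \<open>coc_common\<close> handles these and \<open>coc_common_all\<close> the rest.\<close>
  have common: "card (N y \<inter> N a) = 5" if "y \<in> T" "a \<in> {c, d}" for y a
  proof (cases "y \<in> C")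
    case True
    then show ?thesis using coc_common[OF C, of y a] that cd by (auto simp: T_def rest_def)
  next
    case False
    then show ?thesis using coc_common_all[OF C, of y a] that cd by (auto simp: T_def rest_def)
  qed
  \<comment> \<open>Inclusion-exclusion: 25 - (5 + 5 -
    \<open>card (N y \<inter> P)\<close>).\<close>
  have deg: "card (N y \<inter> T) = 15 + card (N y \<inter> P)" if y: "y \<in> T" for y
  proof -
    have yV: "y \<in> V" and ycd: "c \<notin> N y" "d \<notin> N y" using y by (auto simp: T_def rest_def)
    have nb: "a \<in> N v \<longleftrightarrow> v \<in> N a" if "v \<in> N y" "a \<in> {c, d}" for v a
      using sym[of a v] in_V[OF that(1)] that cd CV by auto
    have "N y \<inter> T = N y - ((N y \<inter> N c) \<union> (N y \<inter> N d))"
      using ycd nb in_V by (auto simp: T_def rest_def)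
    then have "card (N y \<inter> T) = 25 - card ((N y \<inter> N c) \<union> (N y \<inter> N d))"
      using card_N[OF yV] by (simp add: card_Diff_subset)
    moreover have "card ((N y \<inter> N c) \<union> (N y \<inter> N d)) + card (N y \<inter> P) = 10"
      using card_Un_Int[of "N y \<inter> N c" "N y \<inter> N d"] common[OF y] by (simp add: P_def Int_ac)
    ultimately show ?thesis by simp
  qed
  have "int (\<Sum>y\<in>T. card (N y \<inter> T)) = (\<Sum>y\<in>T. 15 + int (card (N y \<inter> P)))"
    using deg by simp
  \<comment> \<open>495 = 33 * 15 is odd. The edges between \<open>T\<close> and \<open>P\<close>
    are recounted from \<open>P\<close>, where each vertex contributes an even number.\<close>
  also have "\<dots> = 495 + (\<Sum>p\<in>P. int (card (N p \<inter> T)))"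
    using sum_card_N_Int[OF TV PV] T33 by (simp add: sum.distrib)
  finally have "int (\<Sum>y\<in>T. card (N y \<inter> T)) = 495 + (\<Sum>p\<in>P. int (card (N p \<inter> T)))" .
  moreover have "even (\<Sum>p\<in>P. int (card (N p \<inter> T)))"
    using card_N_Int_rest_even[OF C cd] by (intro dvd_sum) (auto simp: P_def T_def)
  moreover have "even (int (\<Sum>y\<in>T. card (N y \<inter> T)))"
    using even_sum_degrees[OF TV] by (simp only: even_of_nat)
  ultimately show False by presburger
qed

end

section \<open>Distances 0, 1 and 2 from lengths of walks\<close>

context wf_digraph
begin

lemma graph_dist_le:
  assumes "awalk u p v"
  shows "graph_dist G u v \<le> ereal (real (length p))"
  using min_cost_le_walk_cost[OF assms, of "\<lambda>_. 1"]
  by (simp add: graph_dist_def awalk_cost_def sum_list_triv)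

text \<open>The distance is an infimum of walk costs, and with unit weights the cost of a walk is
  its length.\<close>

lemma graph_dist_ge:
  assumes "\<And>p. awalk u p v \<Longrightarrow> n \<le> length p"
  shows "ereal (real n) \<le> graph_dist G u v"
  unfolding graph_dist_def \<mu>_def
  using assms by (intro INF_greatest) (auto simp: awalk_cost_def sum_list_triv)

lemma adj_imp_awalk: "u \<rightarrow> v \<Longrightarrow> \<exists>e. awalk u [e] v"
  using arc_implies_awalk by (metis reachableE)

lemma awalk_length_1D: "awalk u [e] v \<Longrightarrow> u \<rightarrow> v"
  by (auto simp: awalk_simps arcs_ends_conv)

lemma one_le_awalk_length:
  assumes "u \<noteq> v" "awalk u p v"
  shows "1 \<le> length p"
  using assms by (cases p) (auto simp: awalk_Nil_iff)

lemma two_le_awalk_length: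
  assumes "u \<noteq> v" "\<not> u \<rightarrow> v" "awalk u p v"
  shows "2 \<le> length p"
proof -
  have "length p \<noteq> 1" using assms awalk_length_1D by (auto simp: length_Suc_conv)
  then show ?thesis using one_le_awalk_length[OF assms(1,3)] by linarith
qed

lemma graph_dist_self:
  assumes "u \<in> verts G"
  shows "graph_dist G u u = ereal (real 0)"
proof (rule antisym)
  show "graph_dist G u u \<le> ereal (real 0)"
    using graph_dist_le[of u "[]" u] assms by (simp add: awalk_Nil_iff)
qed (rule graph_dist_ge, simp)

lemma graph_dist_adj:
  assumes "u \<rightarrow> v" "u \<noteq> v"
  shows "graph_dist G u v = ereal (real 1)"
proof (rule antisym)
  obtain e where "awalk u [e] v" using adj_imp_awalk[OF assms(1)] by blast
  then show "graph_dist G u v \<le> ereal (real 1)"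
    by (auto dest: graph_dist_le)
qed (rule graph_dist_ge, rule one_le_awalk_length[OF assms(2)])

lemma graph_dist_eq_2:
  assumes "u \<rightarrow> x" "x \<rightarrow> v" "u \<noteq> v" "\<not> u \<rightarrow> v"
  shows "graph_dist G u v = ereal (real 2)"
proof (rule antisym)
  obtain e f where "awalk u [e] x" "awalk x [f] v"
    using adj_imp_awalk assms by blast
  then have "awalk u ([e] @ [f]) v" by (rule awalk_appendI)
  then show "graph_dist G u v \<le> ereal (real 2)"
    by (auto dest: graph_dist_le)
qed (rule graph_dist_ge, rule two_le_awalk_length[OF assms(3,4)])

end

section \<open>Parameters of the local graph from the intersection array\<close>

theorem proposition4p5:
  fixes G :: "('a, 'b) pre_digraph" and x :: 'a
  assumes "distance_regular G [80, 54, 12] [1, 6, 60]"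
    and "x \<in> verts G"
  shows "\<not> (\<exists>S. coclique (local_graph G x) S \<and> card S = 5)"
proof -
  interpret graph G using assms(1) by (simp add: distance_regular_def)
  have loopfree: "u \<rightarrow>\<^bsub>G\<^esub> v \<Longrightarrow> u \<noteq> v" for u v using adj_not_same by auto
  have adj_sym: "u \<rightarrow>\<^bsub>G\<^esub> v \<longleftrightarrow> v \<rightarrow>\<^bsub>G\<^esub> u" for u v
    using arcs_ends_symmetric[OF sym_arcs] by blast
  have dr: "card {z \<in> verts G. v \<rightarrow>\<^bsub>G\<^esub> z \<and> graph_dist G u z = ereal (real i - 1)} = (0 # [1, 6, 60]) ! i"
    "card {z \<in> verts G. v \<rightarrow>\<^bsub>G\<^esub> z \<and> graph_dist G u z = ereal (real i + 1)} = ([80, 54, 12] @ [0]) ! i"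
    if "i \<le> 3" "u \<in> verts G" "v \<in> verts G" "graph_dist G u v = ereal (real i)" for i u v
    using assms(1) that unfolding distance_regular_def by simp_all
  \<comment> \<open>The degree is b_0, read off at i = 0, since all neighbours of \<open>v\<close>
    are at distance 0 + 1 from \<open>v\<close>.\<close>
  have degree: "card {z \<in> verts G. v \<rightarrow>\<^bsub>G\<^esub> z} = 80" if "v \<in> verts G" for v
  proof -
    have "graph_dist G v z = ereal (real 0 + 1)" if "v \<rightarrow>\<^bsub>G\<^esub> z" for z
      using graph_dist_adj[OF that] loopfree[OF that] by simp
    then have "{z \<in> verts G. v \<rightarrow>\<^bsub>G\<^esub> z} = {z \<in> verts G. v \<rightarrow>\<^bsub>G\<^esub> z \<and> graph_dist G v z = ereal (real 0 + 1)}"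
      by blast
    then show ?thesis using dr(2)[of 0 v v] that graph_dist_self by simp
  qed
  define V where "V = {y \<in> verts G. x \<rightarrow>\<^bsub>G\<^esub> y}"
  define N where "N v = {y \<in> V. v \<rightarrow>\<^bsub>G\<^esub> y}" for v
  interpret L: local_structure V N
  proof
    show "card V = 80" using degree assms by (simp add: V_def)
    show "N v \<subseteq> V" for v by (auto simp: N_def)
    show "u \<in> N v \<longleftrightarrow> v \<in> N u" if "u \<in> V" "v \<in> V" for u v
      using that adj_sym by (auto simp: N_def)
    show "v \<notin> N v" for v using loopfree by (auto simp: N_def)
    show "card (N v) = 25" if "v \<in> V" for v
    proof -
      let ?D = "{z \<in> verts G. v \<rightarrow>\<^bsub>G\<^esub> z \<and> graph_dist G x z = ereal (real 1 + 1)}"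
      have v: "v \<in> verts G" "x \<rightarrow>\<^bsub>G\<^esub> v" "v \<rightarrow>\<^bsub>G\<^esub> x" "x \<noteq> v"
        using that adj_sym loopfree by (auto simp: V_def)
      have d2: "graph_dist G x z = ereal (real 1 + 1) \<longleftrightarrow> z \<noteq> x \<and> \<not> x \<rightarrow>\<^bsub>G\<^esub> z" if "v \<rightarrow>\<^bsub>G\<^esub> z" for z
      proof
        assume "graph_dist G x z = ereal (real 1 + 1)"
        then show "z \<noteq> x \<and> \<not> x \<rightarrow>\<^bsub>G\<^esub> z"
          using graph_dist_self[OF assms(2)] graph_dist_adj[of x z] loopfree[of x z] by auto
      next
        assume "z \<noteq> x \<and> \<not> x \<rightarrow>\<^bsub>G\<^esub> z"
        then show "graph_dist G x z = ereal (real 1 + 1)"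
          using graph_dist_eq_2[OF v(2) that] by auto
      qed
      \<comment> \<open>The neighbours of \<open>v\<close> are at distance 0, 1 or 2 from
        \<open>x\<close>, so \<open>card (N v)\<close> is 80 - 1 - b_1 with b_1 = 54.\<close>
      have "{z \<in> verts G. v \<rightarrow>\<^bsub>G\<^esub> z} = insert x (N v \<union> ?D)"
        using d2 v assms(2) by (auto simp: N_def V_def)
      moreover have "x \<notin> N v \<union> ?D" "N v \<inter> ?D = {}"
        using d2 v loopfree by (auto simp: N_def V_def)
      moreover have "finite (N v)" by (simp add: N_def V_def)
      ultimately have "card {z \<in> verts G. v \<rightarrow>\<^bsub>G\<^esub> z} = Suc (card (N v) + card ?D)"
        by (simp add: card_Un_disjoint)
      moreover have "card ?D = 54"
        using dr(2)[of 1 x v] graph_dist_adj[OF v(2,4)] v assms(2) by simp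
      ultimately show ?thesis using degree[OF v(1)] by simp
    qed
    show "card (N u \<inter> N v) \<le> 5" if "u \<in> V" "v \<in> V" "u \<noteq> v" "v \<notin> N u" for u v
    proof -
      let ?D = "{z \<in> verts G. v \<rightarrow>\<^bsub>G\<^esub> z \<and> graph_dist G u z = ereal (real 2 - 1)}"
      have uv: "u \<in> verts G" "v \<in> verts G" "u \<rightarrow>\<^bsub>G\<^esub> x" "x \<rightarrow>\<^bsub>G\<^esub> v" "v \<rightarrow>\<^bsub>G\<^esub> x" "\<not> u \<rightarrow>\<^bsub>G\<^esub> v"
        using that adj_sym by (auto simp: V_def N_def)
      have one: "graph_dist G u z = ereal (real 2 - 1)" if "u \<rightarrow>\<^bsub>G\<^esub> z" for z
        using graph_dist_adj[OF that loopfree[OF that]] by simp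
      \<comment> \<open>Of the c_2 = 6 common neighbours of \<open>u\<close> and \<open>v\<close> in
        \<open>G\<close>, one is \<open>x\<close>, which lies outside \<open>V\<close>; this leaves
        at most 5.\<close>
      have "insert x (N u \<inter> N v) \<subseteq> ?D"
        using one uv assms(2) by (auto simp: N_def V_def)
      moreover have "x \<notin> N u" using loopfree by (auto simp: N_def V_def)
      moreover have "finite (N u)" by (simp add: N_def V_def)
      ultimately have "Suc (card (N u \<inter> N v)) \<le> card ?D"
        using card_mono[of ?D "insert x (N u \<inter> N v)"] by simp
      moreover have "card ?D = 6"
        using dr(1)[of 2 u v] graph_dist_eq_2[OF uv(3,4) that(3) uv(6)] uv by simp
      ultimately show ?thesis by simp
    qed
  qed
  show ?thesis
  proof
    assume "\<exists>S. coclique (local_graph G x) S \<and> card S = 5"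
    then obtain S where S: "coclique (local_graph G x) S" "card S = 5" by auto
    \<comment> \<open>Absence of loops extends \<open>pairwise\<close>, which speaks of distinct
      vertices only, to all pairs, as \<open>coc\<close> requires.\<close>
    have "\<not> a \<rightarrow>\<^bsub>G\<^esub> b" if "a \<in> S" "b \<in> S" for a b
    proof
      assume ab: "a \<rightarrow>\<^bsub>G\<^esub> b"
      then have "a \<noteq> b" by (rule loopfree)
      moreover have "a \<rightarrow>\<^bsub>local_graph G x\<^esub> b"
        using ab S(1) that unfolding coclique_def local_graph_def arcs_ends_conv by auto
      ultimately show False using S(1) that by (auto simp: coclique_def pairwise_def)
    qed
    moreover have "S \<subseteq> V"
      using S(1) by (auto simp: V_def coclique_def local_graph_def)
    ultimately have "L.coc S"
      using S(2) by (auto simp: L.coc_def N_def)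
    then show False using L.no_coc by blast
  qed
qed

end
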